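(* Let $p$ be a convex polygon in $S^2$, and let $U$ be a non-trivial (isometric) infinitesimal first-order deformation of $p$. Then $b(U)\in(\mathbb{R}_+\setminus\{0\})\,\mathrm{int}(p^* )$, i.e. $b(U)$ is contained in the positive cone over the interior of the dual polygon $p^*$.
   Context: $S^2$ is the unit sphere in $\mathbb{R}^3$. A spherical polygon with $n$ vertices is a finite sequence $p=(v_1,\dots,v_n)$ of points of $S^2$, with $v_0:=v_n$, such that two consecutive vertices are distinct and not antipodal; its edges are the geodesic segments (of length less than $\pi$) joining consecutive vertices, and $\alpha_1,\dots,\alpha_n$ denote its angles. A convex polygon is a polygon which is the boundary of a convex domain in $S^2$, called its interior and denoted by $\mathrm{int}(p)$. Given a convex polygon $p$, the dual polygon $p^*$ is the convex polygon whose interior $\mathrm{int}(p^* )$ is the set of points of $S^2$ which have positive scalar product with the vertices of $p$. A first-order deformation $U$ of $p$ is given by vectors $dv_i(U)\in T_{v_i}S^2$; it is isometric if the lengths of the edges do not change at first order, and trivial if it is the restriction to the vertices of a Killing field of $S^2$, i.e. if there is $Y\in\mathbb{R}^3$ with $dv_i(U)=Y\times v_i$ for all $i$. Let $d\alpha_i(U)$ be the corresponding first-order variation of $\alpha_i$. For an isometric first-order deformation $U$, the quadratic invariant $b$ is $$b(U)=\sum_{i=1}^n d\alpha_i(U)\,dv_i(U)\in\mathbb{R}^3,$$ where the $v_i$ are considered as points of $\mathbb{R}^3$; it does not change when a trivial deformation is added to $U$.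
   Formalization: The vertices of the convex polygon are required to be genuine corners (all angles less than π); if a vertex lies inside a side, moving only it orthogonally to that side gives a non-trivial isometric deformation with b(U) orthogonal to a vertex, so the claim fails. *)

theory Defs
  imports "HOL-Analysis.Analysis"
begin

abbreviation S2 :: "(real ^ 3) set" where
  "S2 \<equiv> sphere 0 1"

section \<open>Spherical polygons\<close>

text \<open>Vertices are numbered from 0, and indices are read cyclically.\<close>

definition next_vertex :: "(real ^ 3) list \<Rightarrow> nat \<Rightarrow> real ^ 3" where
  "next_vertex p i = p ! ((i + 1) mod length p)"

definition prev_vertex :: "(real ^ 3) list \<Rightarrow> nat \<Rightarrow> real ^ 3" where
  "prev_vertex p i = p ! ((i + length p - 1) mod length p)"

definition spherical_polygon :: "(real ^ 3) list \<Rightarrow> bool" where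
  "spherical_polygon p \<longleftrightarrow>
     p \<noteq> [] \<and> set p \<subseteq> S2 \<and>
     (\<forall>i<length p. next_vertex p i \<noteq> p ! i \<and> next_vertex p i \<noteq> - (p ! i))"

text \<open>For \<open>x\<close> and \<open>y\<close> on the sphere, distinct and not antipodal, this is the shorter arc of the
  great circle through them.\<close>

definition geodesic_segment :: "real ^ 3 \<Rightarrow> real ^ 3 \<Rightarrow> (real ^ 3) set" where
  "geodesic_segment x y = {z \<in> S2. \<exists>a b. 0 \<le> a \<and> 0 \<le> b \<and> z = a *\<^sub>R x + b *\<^sub>R y}"

definition edge :: "(real ^ 3) list \<Rightarrow> nat \<Rightarrow> (real ^ 3) set" where
  "edge p i = geodesic_segment (p ! i) (next_vertex p i)"

definition edge_length :: "(real ^ 3) list \<Rightarrow> nat \<Rightarrow> real" where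
  "edge_length p i = arccos (p ! i \<bullet> next_vertex p i)"

text \<open>The component of \<open>x\<close> orthogonal to \<open>v\<close>: for \<open>v\<close> on the sphere it is a positive multiple of
  the initial velocity at \<open>v\<close> of the geodesic segment from \<open>v\<close> to \<open>x\<close>.\<close>

definition tangent_towards :: "real ^ 3 \<Rightarrow> real ^ 3 \<Rightarrow> real ^ 3" where
  "tangent_towards v x = x - (x \<bullet> v) *\<^sub>R v"

text \<open>The angle between the two edges at a vertex, in \<open>[0, \<pi>]\<close>. For a convex polygon, and for the
  polygons near it, this is the interior angle.\<close>

definition vertex_angle :: "(real ^ 3) list \<Rightarrow> nat \<Rightarrow> real" where
  "vertex_angle p i =
     arccos (sgn (tangent_towards (p ! i) (prev_vertex p i)) \<bullet>
             sgn (tangent_towards (p ! i) (next_vertex p i)))"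

section \<open>Convex polygons and their duals\<close>

definition spherically_convex :: "(real ^ 3) set \<Rightarrow> bool" where
  "spherically_convex D \<longleftrightarrow>
     D \<subseteq> S2 \<and> (\<forall>x\<in>D. \<forall>y\<in>D. x \<noteq> - y \<longrightarrow> geodesic_segment x y \<subseteq> D)"

definition convex_domain :: "(real ^ 3) set \<Rightarrow> bool" where
  "convex_domain D \<longleftrightarrow>
     D \<noteq> {} \<and> openin (top_of_set S2) D \<and> connected D \<and> spherically_convex D"

text \<open>The half-open edges are pairwise disjoint exactly when the closed curve formed by the edges is
  injective, i.e. it runs only once around the boundary of the domain.\<close>

definition simple_polygon :: "(real ^ 3) list \<Rightarrow> bool" where
  "simple_polygon p \<longleftrightarrow>
     (\<forall>i<length p. \<forall>j<length p. i \<noteq> j \<longrightarrow>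
        (edge p i - {next_vertex p i}) \<inter> (edge p j - {next_vertex p j}) = {})"

text \<open>The last condition says that the vertices are corners of the domain. Points inside a side are
  not admitted as vertices: take a triangle \<open>(v\<^sub>1, v\<^sub>3, v\<^sub>4)\<close> with one extra vertex \<open>v\<^sub>2\<close> inside the side
  \<open>v\<^sub>1 v\<^sub>3\<close>. Moving only \<open>v\<^sub>2\<close>, orthogonally to that side, is a non-trivial isometric first-order
  deformation whose quadratic invariant is orthogonal to \<open>v\<^sub>1\<close>, \<open>v\<^sub>2\<close> and \<open>v\<^sub>3\<close>, hence not in the open
  dual cone.\<close>

definition convex_polygon :: "(real ^ 3) list \<Rightarrow> bool" where
  "convex_polygon p \<longleftrightarrow>
     spherical_polygon p \<and> simple_polygon p \<and>
     (\<exists>D. convex_domain D \<and> (top_of_set S2) frontier_of D = (\<Union>i<length p. edge p i)) \<and>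
     (\<forall>i<length p. vertex_angle p i < pi)"

definition dual_interior :: "(real ^ 3) list \<Rightarrow> (real ^ 3) set" where
  "dual_interior p = {x \<in> S2. \<forall>v\<in>set p. x \<bullet> v > 0}"

section \<open>First-order deformations\<close>

definition first_order_deformation :: "(real ^ 3) list \<Rightarrow> (real ^ 3) list \<Rightarrow> bool" where
  "first_order_deformation p U \<longleftrightarrow>
     length U = length p \<and> (\<forall>i<length p. U ! i \<bullet> p ! i = 0)"

text \<open>A family of polygons on the sphere which passes through \<open>p\<close> at time 0 with velocity \<open>U\<close>. The
  first-order variations below depend only on this velocity, so that any other differentiable family
  with the same velocity at time 0 gives the same values.\<close>

definition deform :: "(real ^ 3) list \<Rightarrow> (real ^ 3) list \<Rightarrow> real \<Rightarrow> (real ^ 3) list" where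
  "deform p U t = map2 (\<lambda>v u. sgn (v + t *\<^sub>R u)) p U"

definition isometric_deformation :: "(real ^ 3) list \<Rightarrow> (real ^ 3) list \<Rightarrow> bool" where
  "isometric_deformation p U \<longleftrightarrow>
     first_order_deformation p U \<and>
     (\<forall>i<length p. ((\<lambda>t. edge_length (deform p U t) i) has_real_derivative 0) (at 0))"

definition trivial_deformation :: "(real ^ 3) list \<Rightarrow> (real ^ 3) list \<Rightarrow> bool" where
  "trivial_deformation p U \<longleftrightarrow>
     length U = length p \<and> (\<exists>Y. \<forall>i<length p. U ! i = cross3 Y (p ! i))"

definition angle_variation :: "(real ^ 3) list \<Rightarrow> (real ^ 3) list \<Rightarrow> nat \<Rightarrow> real" where
  "angle_variation p U i = deriv (\<lambda>t. vertex_angle (deform p U t) i) 0"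

definition quadratic_invariant :: "(real ^ 3) list \<Rightarrow> (real ^ 3) list \<Rightarrow> real ^ 3" where
  "quadratic_invariant p U = (\<Sum>i<length p. angle_variation p U i *\<^sub>R (U ! i))"

end

theory Submission
  imports Defs
begin

text \<open>Each edge moves rigidly, so an isometric deformation is given by vectors Y(i) with
  U(i) = Y(i) \<times> v(i) and U(i+1) = Y(i) \<times> v(i+1); around the vertex v(i) they jump by
  Y(i) - Y(i-1) = \<plusminus>a(i) v(i), where a(i) is the variation of the angle and the sign is the
  orientation of the polygon. Going once around, sum a(i) v(i) = 0. Hence b . v(k) is, up to sign,
  the sum of a(i) a(j) det(v(k), v(j), v(i)) over j < i, starting from v(k). Seen from v(k) (gnomonic
  projection) the other vertices have increasing slopes t(j) with positive weights f(j), and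
  det(v(k), v(j), v(i)) is proportional to f(i) f(j) (t(i) - t(j)). Summation by parts turns the form
  into a sum of (t(m+1) - t(m)) P(m)^2, where P(m) is the partial sum of the a(j) f(j); it vanishes
  only if all angles are constant to first order, i.e. if all Y(i) agree.
  For the determinants to have the same sign as the orientation, a supporting plane of the cone
  over the domain at the midpoint of each edge puts all vertices weakly on one side; a further
  vertex on the great circle of an edge would, by the half-spaces of the two neighbouring edges,
  lie on the edge itself.\<close>

unbundle cross3_syntax

abbreviation triple :: "real^3 \<Rightarrow> real^3 \<Rightarrow> real^3 \<Rightarrow> real" where
  "triple x y z \<equiv> (x \<times> y) \<bullet> z"

section \<open>Summation by parts and the quadratic form\<close>

text \<open>The inner sum equals the sum of \<open>(t (Suc m) - t m) * P (Suc m)\<close> over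
  \<open>m < i\<close>; exchanging the two summations leaves at each \<open>m\<close> the tail
  \<open>P (Suc N) - P (Suc m)\<close> of \<open>c\<close>. When the total \<open>P (Suc N)\<close>
  vanishes, this is minus a weighted sum of squares.\<close>

lemma double_sum_by_parts:
  fixes c t :: "nat \<Rightarrow> real"
  defines "P \<equiv> \<lambda>i. \<Sum>j<i. c j"
  shows "(\<Sum>i<Suc N. c i * (\<Sum>j<i. c j * (t i - t j))) =
         (\<Sum>m<N. (t (Suc m) - t m) * P (Suc m) * (P (Suc N) - P (Suc m)))"
proof -
  have R: "(\<Sum>j<i. c j * (t i - t j)) = (\<Sum>m<i. (t (Suc m) - t m) * P (Suc m))" for i
  proof (induction i)
    case (Suc i)
    have "(\<Sum>j<Suc i. c j * (t (Suc i) - t j)) =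
        (\<Sum>j<Suc i. c j * (t i - t j)) + (\<Sum>j<Suc i. c j * (t (Suc i) - t i))"
      by (simp only: sum.distrib[symmetric]) (simp add: algebra_simps)
    also have "\<dots> = (\<Sum>j<i. c j * (t i - t j)) + P (Suc i) * (t (Suc i) - t i)"
      by (simp add: P_def sum_distrib_right distrib_right)
    finally show ?case using Suc by (simp add: algebra_simps)
  qed simp
  show ?thesis
  proof (induction N)
    case (Suc N)
    have PS: "P (Suc (Suc N)) = P (Suc N) + c (Suc N)" by (simp add: P_def)
    have "(\<Sum>i<Suc (Suc N). c i * (\<Sum>j<i. c j * (t i - t j))) =
      (\<Sum>m<N. (t (Suc m) - t m) * P (Suc m) * (P (Suc N) - P (Suc m))) +
      c (Suc N) * (\<Sum>m<Suc N. (t (Suc m) - t m) * P (Suc m))"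
      using Suc R[of "Suc N"] by simp
    also have "\<dots> = (\<Sum>m<Suc N. (t (Suc m) - t m) * P (Suc m) * (P (Suc (Suc N)) - P (Suc m)))"
      by (simp add: PS sum_distrib_left algebra_simps sum.distrib sum_subtractf)
    finally show ?case .
  qed simp
qed

lemma sum_periodic_shift:
  fixes F :: "nat \<Rightarrow> 'a::ab_group_add"
  assumes "\<And>i. F (i + n) = F i"
  shows "(\<Sum>i<n. F (i + k)) = (\<Sum>i<n. F i)"
proof (induction k)
  case (Suc k)
  have "(\<Sum>i<n. F (Suc i + k)) + F k = (\<Sum>i<Suc n. F (i + k))"
    by (simp only: sum.lessThan_Suc_shift) (simp add: add.commute)
  also have "\<dots> = (\<Sum>i<n. F (i + k)) + F k"
    using assms[of k] by (simp add: add.commute)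
  finally show ?case using Suc by simp
qed simp

text \<open>For fixed \<open>x\<close> the determinant is an area form on the quotient plane by
  \<open>x\<close>; this is the three-term Pluecker relation for four vectors of that plane.\<close>

lemma triple_pluecker:
  "triple x y z * triple x w s = triple x y s * triple z x w - triple x y w * triple z x s"
  by (simp add: cross3_simps)

text \<open>With \<open>b\<close> the sum of \<open>a i\<close> times
  \<open>Y i \<times> v i\<close>, the sum in the conclusion is the inner product of
  \<open>b\<close> with \<open>v 0\<close>. Treating one vertex suffices: all hypotheses survive a
  shift of the indices.\<close>

lemma polygon_form_pos:
  fixes v Y :: "nat \<Rightarrow> real^3" and a :: "nat \<Rightarrow> real"
  assumes n: "n \<ge> 3" and eps: "\<epsilon> * \<epsilon> = (1::real)"
    and vper: "\<And>i. v (i + n) = v i" and Yper: "\<And>i. Y (i + n) = Y i"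
    and aper: "\<And>i. a (i + n) = a i"
    and edge: "\<And>i j. 2 \<le> j \<Longrightarrow> j < n \<Longrightarrow> \<epsilon> * triple (v i) (v (i + 1)) (v (i + j)) > 0"
    and step: "\<And>i. Y (Suc i) = Y i - (\<epsilon> * a (Suc i)) *\<^sub>R v (Suc i)"
    and nz: "a k \<noteq> 0"
  shows "(\<Sum>i<n. a i * triple (Y i) (v i) (v 0)) > 0"
proof -
  obtain M where M: "n = Suc (Suc M)" and M1: "M \<ge> 1"
    using n by (metis Suc_le_D Suc_le_mono numeral_3_eq_3 One_nat_def)
  have v0: "v n = v 0" using vper[of 0] by simp
  \<comment> \<open>By \<open>step\<close> and \<open>\<epsilon> * \<epsilon> = 1\<close>, each
    summand is \<open>\<epsilon>\<close> times a jump of \<open>Y\<close>, and the jumps telescope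
    to zero over one period.\<close>
  have closed: "(\<Sum>i<n. a i *\<^sub>R v i) = 0"
  proof -
    have "(\<Sum>i<n. a i *\<^sub>R v i) = (\<Sum>i<n. a (Suc i) *\<^sub>R v (Suc i))"
      using sum_periodic_shift[of "\<lambda>i. a i *\<^sub>R v i" n 1] by (simp add: aper vper)
    also have "\<dots> = (\<Sum>i<n. \<epsilon> *\<^sub>R (Y i - Y (Suc i)))"
      using eps by (intro sum.cong) (auto simp: step mult.assoc[symmetric])
    also have "\<dots> = \<epsilon> *\<^sub>R (Y 0 - Y n)"
      by (simp only: scaleR_sum_right[symmetric] sum_lessThan_telescope')
    also have "\<dots> = 0" using Yper[of 0] by simp
    finally show ?thesis .
  qed
  have Yform: "Y (Suc j) = Y 0 - \<epsilon> *\<^sub>R (\<Sum>l<Suc j. a (Suc l) *\<^sub>R v (Suc l))" for j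
    by (induction j) (simp_all add: step algebra_simps)
  \<comment> \<open>\<open>?D1\<close> and \<open>?D2\<close> test against the two edges at
    \<open>v 0\<close>. On the vertices other than \<open>v 0\<close> each is nonnegative and
    vanishes only at the far end of its edge, so their sum \<open>f\<close> is positive there, while
    it is zero at \<open>v 0\<close> itself.\<close>
  let ?D1 = "\<lambda>i. \<epsilon> * triple (v 0) (v 1) (v i)"
  let ?D2 = "\<lambda>i. \<epsilon> * triple (v (n-1)) (v 0) (v i)"
  define f where "f i = ?D1 i + ?D2 i" for i
  define \<Delta> where "\<Delta> = ?D1 (n-1)"
  have \<Delta>: "\<Delta> > 0" using edge[of "n-1" 0] n by (simp add: \<Delta>_def)
  have D1: "?D1 i \<ge> 0" "i \<noteq> 1 \<Longrightarrow> ?D1 i > 0" if "1 \<le> i" "i < n" for i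
    using edge[of i 0] that by (cases "i = 1"; force simp: cross3_simps)+
  have D2: "?D2 i \<ge> 0" "i \<noteq> n - 1 \<Longrightarrow> ?D2 i > 0" if "1 \<le> i" "i < n" for i
  proof -
    \<comment> \<open>Counted from \<open>v (n-1)\<close>, the vertex \<open>v i\<close> has number
      \<open>i + 1\<close>, because \<open>v n = v 0\<close>.\<close>
    have "?D2 i > 0" if "i \<noteq> n - 1"
      using edge[of "i+1" "n-1"] that \<open>1 \<le> i\<close> \<open>i < n\<close> n vper[of i] v0
      by (simp add: add.commute)
    moreover have "?D2 (n-1) = 0" by (simp add: cross3_simps)
    ultimately show "?D2 i \<ge> 0" "i \<noteq> n - 1 \<Longrightarrow> ?D2 i > 0" by fastforce+
  qed
  have fpos: "f i > 0" if "1 \<le> i" "i < n" for i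
  proof (cases "i = 1")
    case True
    then have "i \<noteq> n - 1" using n by simp
    from D2(2)[OF that this] D1(1)[OF that] show ?thesis unfolding f_def by linarith
  next
    case False
    from D1(2)[OF that this] D2(1)[OF that] show ?thesis unfolding f_def by linarith
  qed
  \<comment> \<open>The slopes and weights concern only the vertices other than \<open>v 0\<close>,
    so index \<open>j\<close> stands for \<open>v (Suc j)\<close>.\<close>
  define t where "t j = ?D1 (Suc j) / f (Suc j)" for j
  define c where "c j = a (Suc j) * f (Suc j)" for j
  have ff: "f (Suc i) * f (Suc j) * (t i - t j) = \<Delta> * (\<epsilon> * triple (v 0) (v (Suc j)) (v (Suc i)))"
    if "i < Suc M" "j < Suc M" for i j
  proof -
    have "f (Suc i) * f (Suc j) * (t i - t j) = ?D1 (Suc i) * f (Suc j) - ?D1 (Suc j) * f (Suc i)"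
      using fpos[of "Suc i"] fpos[of "Suc j"] that M by (simp add: t_def field_simps)
    \<comment> \<open>The products of two \<open>?D1\<close> values cancel; what remains is the
      Pluecker expansion with \<open>v 0\<close> as the common vector.\<close>
    also have "\<dots> = (\<epsilon> * \<epsilon>) * (triple (v 0) (v 1) (v (n-1)) * triple (v 0) (v (Suc j)) (v (Suc i)))"
      unfolding triple_pluecker f_def by (simp add: algebra_simps)
    finally show ?thesis by (simp add: \<Delta>_def algebra_simps)
  qed
  define P where "P i = (\<Sum>j<i. c j)" for i
  \<comment> \<open>\<open>L\<close> is the linear functional whose values at the vertices are
    \<open>f\<close>. Applied to \<open>closed\<close> it loses the term of index 0, since
    \<open>L (v 0) = 0\<close>.\<close>
  have Ptot: "P (Suc M) = 0"
  proof -
    define L where "L x = \<epsilon> * triple (v 0) (v 1) x + \<epsilon> * triple (v (n-1)) (v 0) x" for x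
    have "(\<Sum>i<n. a i * L (v i)) = L (\<Sum>i<n. a i *\<^sub>R v i)"
      by (simp add: L_def inner_sum_right sum.distrib sum_distrib_left algebra_simps)
    also have "\<dots> = 0" by (simp add: closed L_def)
    finally have "(\<Sum>i<n. a i * L (v i)) = 0" .
    moreover have "L (v 0) = 0" by (simp add: L_def cross3_simps)
    ultimately show ?thesis
      unfolding M sum.lessThan_Suc_shift P_def c_def f_def L_def by simp
  qed
  have hj: "a (Suc j) * triple (Y (Suc j)) (v (Suc j)) (v 0) =
      a (Suc j) * triple (Y 0) (v (Suc j)) (v 0) - (c j * (\<Sum>l<j. c l * (t j - t l))) / \<Delta>"
    if "j < Suc M" for j
  proof -
    have lin: "triple (Y 0 - \<epsilon> *\<^sub>R S) y z = triple (Y 0) y z - \<epsilon> * (S \<bullet> (y \<times> z))" for S y z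
      by (simp add: cross3_simps)
    have "triple (Y (Suc j)) (v (Suc j)) (v 0) = triple (Y 0) (v (Suc j)) (v 0)
        - \<epsilon> * (\<Sum>l<Suc j. a (Suc l) * (v (Suc l) \<bullet> (v (Suc j) \<times> v 0)))"
      unfolding Yform lin inner_sum_left inner_scaleR_left ..
    \<comment> \<open>The summand \<open>l = j\<close> contains \<open>v (Suc j)\<close> twice and
      drops out, so the form involves only pairs \<open>l < j\<close>.\<close>
    also have "(\<Sum>l<Suc j. a (Suc l) * (v (Suc l) \<bullet> (v (Suc j) \<times> v 0)))
       = (\<Sum>l<j. a (Suc l) * triple (v 0) (v (Suc l)) (v (Suc j)))"
      by (simp add: dot_cross_self) (intro sum.cong; simp add: cross3_simps)
    also have "\<epsilon> * \<dots> = (\<Sum>l<j. c l * (t j - t l) * f (Suc j) / \<Delta>)"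
      unfolding sum_distrib_left
    proof (intro sum.cong refl)
      fix l assume "l \<in> {..<j}"
      then have "\<epsilon> * triple (v 0) (v (Suc l)) (v (Suc j)) = f (Suc j) * f (Suc l) * (t j - t l) / \<Delta>"
        using ff[of j l] that \<Delta> by (simp add: nonzero_eq_divide_eq mult.commute)
      then show "\<epsilon> * (a (Suc l) * triple (v 0) (v (Suc l)) (v (Suc j))) = c l * (t j - t l) * f (Suc j) / \<Delta>"
        by (simp add: c_def mult.left_commute[of \<epsilon>])
    qed
    finally show ?thesis
      by (simp add: c_def right_diff_distrib sum_distrib_left sum_distrib_right sum_divide_distrib mult_ac)
  qed
  have tinc: "t (Suc m) - t m > 0" if "m < M" for m
  proof -
    \<comment> \<open>After a cyclic permutation this tests \<open>v 0\<close> against the edge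
      starting at \<open>v (Suc m)\<close>, from which \<open>v 0\<close> is
      \<open>n - Suc m\<close> places ahead.\<close>
    have "\<epsilon> * triple (v 0) (v (Suc m)) (v (Suc (Suc m))) > 0"
      using edge[of "n - Suc m" "Suc m"] that M v0 by (simp add: cross3_simps)
    then have "f (Suc (Suc m)) * f (Suc m) * (t (Suc m) - t m) > 0"
      using ff[of "Suc m" m] that \<Delta> by simp
    moreover have "f (Suc (Suc m)) * f (Suc m) > 0"
      using fpos[of "Suc (Suc m)"] fpos[of "Suc m"] that M by simp
    ultimately show ?thesis using zero_less_mult_pos by blast
  qed
  \<comment> \<open>The common rotation \<open>Y 0\<close> contributes nothing, by
    \<open>closed\<close>; this is the invariance of \<open>b\<close> under trivial
    deformations.\<close>
  have "(\<Sum>i<n. a i * triple (Y 0) (v i) (v 0)) = triple (Y 0) (\<Sum>i<n. a i *\<^sub>R v i) (v 0)"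
    by (simp add: Cross3.cross_triple[of _ "v 0"] inner_sum_right inner_sum_left cross3_simps sum.distrib sum_distrib_left sum_subtractf)
  then have Y0: "(\<Sum>i<n. a i * triple (Y 0) (v i) (v 0)) = 0" by (simp add: closed)
  have s0: "(\<Sum>i<n. a i * triple (Z i) (v i) (v 0)) = (\<Sum>j<Suc M. a (Suc j) * triple (Z (Suc j)) (v (Suc j)) (v 0))" for Z
    unfolding M sum.lessThan_Suc_shift by (simp add: dot_cross_self)
  have "(\<Sum>i<n. a i * triple (Y i) (v i) (v 0)) =
      - (\<Sum>i<Suc M. c i * (\<Sum>j<i. c j * (t i - t j))) / \<Delta>"
  proof -
    have "(\<Sum>i<n. a i * triple (Y i) (v i) (v 0)) =
      (\<Sum>j<Suc M. a (Suc j) * triple (Y 0) (v (Suc j)) (v 0) - (c j * (\<Sum>l<j. c l * (t j - t l))) / \<Delta>)"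
      unfolding s0 using hj by (intro sum.cong) auto
    also have "\<dots> = - (\<Sum>i<Suc M. c i * (\<Sum>j<i. c j * (t i - t j))) / \<Delta>"
      unfolding sum_subtractf s0[of "\<lambda>_. Y 0", symmetric] Y0
      by (simp only: sum_divide_distrib[symmetric] diff_0 minus_divide_left)
    finally show ?thesis .
  qed
  also have "\<dots> = (\<Sum>m<M. (t (Suc m) - t m) * (P (Suc m))\<^sup>2) / \<Delta>"
    unfolding double_sum_by_parts P_def[symmetric] Ptot
    by (simp add: sum_negf power2_eq_square mult.assoc)
  finally have eq: "(\<Sum>i<n. a i * triple (Y i) (v i) (v 0)) =
     (\<Sum>m<M. (t (Suc m) - t m) * (P (Suc m))\<^sup>2) / \<Delta>" .
  \<comment> \<open>If all partial sums vanished, so would every \<open>c j\<close>, hence every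
    \<open>a (Suc j)\<close> because \<open>f\<close> is positive; \<open>closed\<close> would then
    force \<open>a 0 = 0\<close>.\<close>
  have "\<exists>m<M. P (Suc m) \<noteq> 0"
  proof (rule ccontr)
    assume "\<not> ?thesis"
    then have P0: "P m = 0" if "m \<le> Suc M" for m
      using that Ptot by (cases m) (auto simp: P_def le_less)
    have "c j = 0" if "j < Suc M" for j
      using P0[of j] P0[of "Suc j"] that by (simp add: P_def)
    then have a0: "a (Suc j) = 0" if "j < Suc M" for j
      using fpos[of "Suc j"] that M unfolding c_def by fastforce
    have "a 0 *\<^sub>R v 0 = 0" using closed a0 unfolding M sum.lessThan_Suc_shift by simp
    moreover have "v 0 \<noteq> 0" using \<Delta> unfolding \<Delta>_def by auto
    ultimately have "a 0 = 0" by simp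
    then have "a i = 0" if "i < n" for i using a0 that M by (cases i) auto
    moreover have "a k = a (k mod n)"
    proof -
      have "a (r + q * n) = a r" for r q
        by (induction q) (simp_all add: aper add.assoc[symmetric] add.commute[of n])
      from this[of "k mod n" "k div n"] show ?thesis by simp
    qed
    ultimately show False using nz n by simp
  qed
  then obtain m where "m < M" "P (Suc m) \<noteq> 0" by blast
  then have "(\<Sum>m<M. (t (Suc m) - t m) * (P (Suc m))\<^sup>2) > 0"
    using tinc by (intro sum_pos2[of _ m]) (auto simp: less_imp_le)
  then show ?thesis unfolding eq using \<Delta> by simp
qed

section \<open>Derivatives along an isometric deformation\<close>

lemma eq_of_inner_basis_eq:
  fixes x y :: "real^3"
  assumes "x \<times> y \<noteq> 0" "p \<bullet> x = q \<bullet> x" "p \<bullet> y = q \<bullet> y" "p \<bullet> (x \<times> y) = q \<bullet> (x \<times> y)"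
  shows "p = q"
proof -
  have "(p - q) \<times> (x \<times> y) = 0" unfolding Lagrange using assms by (simp add: inner_diff_left)
  moreover have "(p - q) \<bullet> (x \<times> y) = 0" using assms by (simp add: inner_diff_left)
  ultimately show ?thesis using norm_and_cross_eq_0[of "p - q" "x \<times> y"] assms(1) by simp
qed

text \<open>The hypotheses say that the lengths of \<open>x\<close> and \<open>y\<close> and their
  inner product are stationary, so the pair moves rigidly to first order. It provides the rotation
  vector of each edge.\<close>

lemma exists_rotation_field:
  fixes x y u w :: "real^3"
  assumes nz: "x \<times> y \<noteq> 0" and "u \<bullet> x = 0" "w \<bullet> y = 0" "u \<bullet> y + x \<bullet> w = 0"
  shows "\<exists>Y. u = Y \<times> x \<and> w = Y \<times> y"
proof -
  define N where "N = x \<times> y"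
  define D where "D = N \<bullet> N"
  have D: "D \<noteq> 0" using nz by (simp add: D_def N_def)
  \<comment> \<open>The coefficients in the basis \<open>x\<close>, \<open>y\<close>,
    \<open>N\<close> are forced: those of \<open>x\<close> and \<open>y\<close> by the components of
    \<open>w\<close> and \<open>u\<close> along \<open>N\<close>, that of \<open>N\<close> by
    \<open>u \<bullet> y\<close>. The remaining equation, for \<open>w \<bullet> x\<close>, is the
    last hypothesis.\<close>
  define Y where "Y = (w \<bullet> N / D) *\<^sub>R x - (u \<bullet> N / D) *\<^sub>R y + (u \<bullet> y / D) *\<^sub>R N"
  have Dxy: "D = (x \<bullet> x) * (y \<bullet> y) - (x \<bullet> y)\<^sup>2"
    unfolding D_def N_def dot_cross by (simp add: power2_eq_square inner_commute)
  have yx: "(y \<times> x) = - N" unfolding N_def by (rule cross_skew)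
  have Nx: "N \<times> x = (x \<bullet> x) *\<^sub>R y - (x \<bullet> y) *\<^sub>R x"
    unfolding N_def by (subst cross_skew) (simp add: Lagrange)
  have Ny: "N \<times> y = (x \<bullet> y) *\<^sub>R y - (y \<bullet> y) *\<^sub>R x"
    unfolding N_def by (subst cross_skew) (simp add: Lagrange inner_commute)
  have Nxy: "N \<bullet> x = 0" "N \<bullet> y = 0" "x \<bullet> N = 0" "y \<bullet> N = 0" unfolding N_def by (simp_all add: dot_cross_self)
  have Yx: "Y \<times> x = (u \<bullet> N / D) *\<^sub>R N + (u \<bullet> y / D) *\<^sub>R ((x \<bullet> x) *\<^sub>R y - (x \<bullet> y) *\<^sub>R x)"
    unfolding Y_def by (simp add: cross_add_left Cross3.left_diff_distrib cross_mult_left Nx yx)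
  have Yy: "Y \<times> y = (w \<bullet> N / D) *\<^sub>R N + (u \<bullet> y / D) *\<^sub>R ((x \<bullet> y) *\<^sub>R y - (y \<bullet> y) *\<^sub>R x)"
    unfolding Y_def by (simp add: cross_add_left Cross3.left_diff_distrib cross_mult_left Ny N_def[symmetric])
  have xw: "w \<bullet> x = - (u \<bullet> y)" using assms(4) by (simp add: inner_commute)
  have "u = Y \<times> x"
  proof (rule eq_of_inner_basis_eq[OF nz])
    show "u \<bullet> x = (Y \<times> x) \<bullet> x" by (simp add: dot_cross_self assms)
    have "(Y \<times> x) \<bullet> y = u \<bullet> y / D * ((x \<bullet> x) * (y \<bullet> y) - (x \<bullet> y)\<^sup>2)"
      unfolding Yx by (simp add: inner_add_left inner_diff_left Nxy power2_eq_square)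
    then show "u \<bullet> y = (Y \<times> x) \<bullet> y" using D by (simp flip: Dxy)
    show "u \<bullet> (x \<times> y) = (Y \<times> x) \<bullet> (x \<times> y)" unfolding N_def[symmetric] Yx
      using D by (simp add: inner_add_left inner_diff_left Nxy D_def[symmetric])
  qed
  moreover have "w = Y \<times> y"
  proof (rule eq_of_inner_basis_eq[OF nz])
    show "w \<bullet> y = (Y \<times> y) \<bullet> y" by (simp add: dot_cross_self assms)
    have "(Y \<times> y) \<bullet> x = - (u \<bullet> y / D * ((x \<bullet> x) * (y \<bullet> y) - (x \<bullet> y)\<^sup>2))"
      unfolding Yy by (simp add: inner_add_left inner_diff_left Nxy power2_eq_square inner_commute algebra_simps)
    then show "w \<bullet> x = (Y \<times> y) \<bullet> x" using D xw by (simp flip: Dxy)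
    show "w \<bullet> (x \<times> y) = (Y \<times> y) \<bullet> (x \<times> y)" unfolding N_def[symmetric] Yy
      using D by (simp add: inner_add_left inner_diff_left Nxy D_def[symmetric])
  qed
  ultimately show ?thesis by blast
qed

text \<open>Two rotation vectors that move the unit vector \<open>v\<close> in the same way differ
  by a rotation about \<open>v\<close>. This gives the jump of \<open>Y\<close> at a vertex shared
  by two edges.\<close>

lemma parallel_of_cross_eq:
  fixes v :: "real^3"
  assumes "norm v = 1" "Y \<times> v = Z \<times> v"
  shows "Y - Z = ((Y - Z) \<bullet> v) *\<^sub>R v"
proof -
  have "v \<times> ((Y - Z) \<times> v) = 0" using assms(2) by (simp add: Cross3.left_diff_distrib)
  then show ?thesis unfolding Lagrange using assms(1) by (simp add: dot_square_norm inner_commute)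
qed

text \<open>By orthogonality the norm of \<open>v + t *\<^sub>R u\<close> is even in
  \<open>t\<close>, hence stationary at 0, and normalising does not change the velocity.\<close>

lemma sgn_curve_has_derivative:
  fixes v u :: "real^3"
  assumes "norm v = 1" "u \<bullet> v = 0"
  shows "((\<lambda>t. sgn (v + t *\<^sub>R u)) has_vector_derivative u) (at 0)"
proof -
  have n: "norm (v + t *\<^sub>R u) = sqrt (1 + t\<^sup>2 * (u \<bullet> u))" for t
    using assms by (simp add: norm_eq_sqrt_inner inner_add_left inner_add_right inner_commute
        power2_eq_square algebra_simps norm_eq_1)
  have "((\<lambda>t. inverse (sqrt (1 + t\<^sup>2 * (u \<bullet> u)))) has_real_derivative 0) (at 0)"
    by (auto intro!: derivative_eq_intros)
  then have "((\<lambda>t. inverse (sqrt (1 + t\<^sup>2 * (u \<bullet> u))) *\<^sub>R (v + t *\<^sub>R u)) has_vector_derivative u) (at 0)"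
    by (auto intro!: derivative_eq_intros)
  then show ?thesis by (simp add: sgn_div_norm n)
qed

lemma sgn_curves_inner_derivative:
  fixes v u x w :: "real^3"
  assumes "norm v = 1" "u \<bullet> v = 0" "norm x = 1" "w \<bullet> x = 0"
  shows "((\<lambda>t. sgn (v + t *\<^sub>R u) \<bullet> sgn (x + t *\<^sub>R w)) has_real_derivative (u \<bullet> x + v \<bullet> w)) (at 0)"
proof -
  have "((\<lambda>t. sgn (v + t *\<^sub>R u) \<bullet> sgn (x + t *\<^sub>R w)) has_derivative
     (\<lambda>h. sgn (v + 0 *\<^sub>R u) \<bullet> (h *\<^sub>R w) + (h *\<^sub>R u) \<bullet> sgn (x + 0 *\<^sub>R w))) (at 0)"
    using sgn_curve_has_derivative assms unfolding has_vector_derivative_def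
    by (intro has_derivative_inner) auto
  moreover have "sgn v = v" "sgn x = x" using assms by (simp_all add: sgn_div_norm)
  ultimately show ?thesis unfolding has_field_derivative_def
    by (auto elim!: has_derivative_eq_rhs simp: fun_eq_iff algebra_simps)
qed

text \<open>This is the Gram determinant of three unit vectors, arranged to match the law of cosines
  at \<open>y\<close>: it expresses the sine of the angle at \<open>y\<close> by the
  determinant.\<close>

lemma gram_triple:
  fixes x y z :: "real^3"
  assumes "norm x = 1" "norm y = 1" "norm z = 1"
  shows "(triple x y z)\<^sup>2 = (1 - (x \<bullet> y)\<^sup>2) * (1 - (z \<bullet> y)\<^sup>2) - (x \<bullet> z - (x \<bullet> y) * (z \<bullet> y))\<^sup>2"
proof -
  have "(triple x y z)\<^sup>2 = (x \<bullet> x) * (y \<bullet> y) * (z \<bullet> z) + 2 * (x \<bullet> y) * (z \<bullet> y) * (x \<bullet> z)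
     - (x \<bullet> x) * (z \<bullet> y)\<^sup>2 - (y \<bullet> y) * (x \<bullet> z)\<^sup>2 - (z \<bullet> z) * (x \<bullet> y)\<^sup>2"
    by (simp add: cross3_simps power2_eq_square)
  also have "x \<bullet> x = 1" using assms by (simp add: norm_eq_1)
  also have "y \<bullet> y = 1" using assms by (simp add: norm_eq_1)
  also have "z \<bullet> z = 1" using assms by (simp add: norm_eq_1)
  finally show ?thesis by (simp add: power2_eq_square algebra_simps)
qed

text \<open>This is \<open>vertex_angle\<close> at the middle argument, detached from lists and
  cyclic indices.\<close>

definition angle_between :: "real^3 \<Rightarrow> real^3 \<Rightarrow> real^3 \<Rightarrow> real" where
  "angle_between x y z = arccos (sgn (tangent_towards y x) \<bullet> sgn (tangent_towards y z))"

lemma norm_tangent_towards: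
  assumes "norm x = 1" "norm y = 1"
  shows "norm (tangent_towards y x) = sqrt (1 - (x \<bullet> y)\<^sup>2)"
  using assms by (simp add: norm_eq_sqrt_inner tangent_towards_def inner_diff_left inner_diff_right
      inner_commute power2_eq_square norm_eq_1)

text \<open>This is the spherical law of cosines at \<open>y\<close>.\<close>

lemma cos_angle_between:
  assumes "norm x = 1" "norm y = 1" "norm z = 1"
  shows "sgn (tangent_towards y x) \<bullet> sgn (tangent_towards y z) =
    (x \<bullet> z - (x \<bullet> y) * (z \<bullet> y)) / (sqrt (1 - (x \<bullet> y)\<^sup>2) * sqrt (1 - (z \<bullet> y)\<^sup>2))"
proof -
  have "tangent_towards y x \<bullet> tangent_towards y z = x \<bullet> z - (x \<bullet> y) * (z \<bullet> y)"
    using assms by (simp add: tangent_towards_def inner_diff_left inner_diff_right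
      inner_commute norm_eq_1)
  then show ?thesis
    by (simp add: sgn_div_norm norm_tangent_towards assms field_simps)
qed

text \<open>In the law of cosines the two sides at \<open>Y\<close> are stationary, so only the
  numerator varies, at rate \<open>dA\<close>. The sine of the angle is the absolute determinant
  divided by the same denominator, which cancels. The condition \<open>T\<close> keeps the cosine
  strictly between -1 and 1, where arccos is differentiable.\<close>

lemma angle_between_has_derivative:
  fixes X Y Z :: "real \<Rightarrow> real^3"
  assumes unit: "\<And>t. norm (X t) = 1" "\<And>t. norm (Y t) = 1" "\<And>t. norm (Z t) = 1"
    and A: "((\<lambda>t. X t \<bullet> Z t) has_real_derivative dA) (at 0)"
    and B: "((\<lambda>t. X t \<bullet> Y t) has_real_derivative 0) (at 0)"
    and C: "((\<lambda>t. Z t \<bullet> Y t) has_real_derivative 0) (at 0)"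
    and T: "triple (X 0) (Y 0) (Z 0) \<noteq> 0"
  shows "((\<lambda>t. angle_between (X t) (Y t) (Z t)) has_real_derivative
           - dA / \<bar>triple (X 0) (Y 0) (Z 0)\<bar>) (at 0)"
proof -
  define b c where "b = 1 - (X 0 \<bullet> Y 0)\<^sup>2" and "c = 1 - (Z 0 \<bullet> Y 0)\<^sup>2"
  define e where "e = X 0 \<bullet> Z 0 - (X 0 \<bullet> Y 0) * (Z 0 \<bullet> Y 0)"
  have gram: "(triple (X 0) (Y 0) (Z 0))\<^sup>2 = b * c - e\<^sup>2"
    unfolding b_def c_def e_def using gram_triple unit by blast
  have b0: "b \<ge> 0" using Cauchy_Schwarz_ineq[of "X 0" "Y 0"] unit by (simp add: b_def norm_eq_1)
  have c0: "c \<ge> 0" using Cauchy_Schwarz_ineq[of "Z 0" "Y 0"] unit by (simp add: c_def norm_eq_1)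
  have Tpos: "(triple (X 0) (Y 0) (Z 0))\<^sup>2 > 0" using T by simp
  have "b * c > 0" using gram Tpos by (smt (verit) zero_le_power2)
  with b0 c0 have bc: "b > 0" "c > 0" by (auto simp: zero_less_mult_iff)
  let ?q = "\<lambda>t. (X t \<bullet> Z t - (X t \<bullet> Y t) * (Z t \<bullet> Y t)) /
     (sqrt (1 - (X t \<bullet> Y t)\<^sup>2) * sqrt (1 - (Z t \<bullet> Y t)\<^sup>2))"
  have q0: "?q 0 = e / sqrt (b * c)" by (simp add: b_def c_def e_def real_sqrt_mult)
  have sq: "1 - (?q 0)\<^sup>2 = (triple (X 0) (Y 0) (Z 0))\<^sup>2 / (b * c)"
    unfolding q0 gram using bc by (simp add: power_divide field_simps)
  have "(?q 0)\<^sup>2 < 1" using sq Tpos bc by (smt (verit) divide_pos_pos mult_pos_pos)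
  then have q1: "-1 < ?q 0" "?q 0 < 1" unfolding abs_square_less_1 abs_less_iff by linarith+
  have dq: "(?q has_real_derivative dA / sqrt (b * c)) (at 0)"
  proof -
    obtain r where r: "r = sqrt (b * c)" "r > 0" using bc by simp
    have s: "sqrt (1 - (X 0 \<bullet> Y 0)\<^sup>2) * sqrt (1 - (Z 0 \<bullet> Y 0)\<^sup>2) = r"
      by (simp add: r b_def c_def real_sqrt_mult)
    have den: "((\<lambda>t. sqrt (1 - (X t \<bullet> Y t)\<^sup>2) * sqrt (1 - (Z t \<bullet> Y t)\<^sup>2)) has_real_derivative 0) (at 0)"
      using bc by (auto simp: b_def c_def intro!: derivative_eq_intros B C)
    have num: "((\<lambda>t. X t \<bullet> Z t - (X t \<bullet> Y t) * (Z t \<bullet> Y t)) has_real_derivative dA) (at 0)"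
      by (auto intro!: derivative_eq_intros A B C)
    show ?thesis
      using DERIV_divide[OF num den] r(2) unfolding s r(1)[symmetric] by (auto elim!: DERIV_cong)
  qed
  have "((\<lambda>t. arccos (?q t)) has_real_derivative inverse (- sqrt (1 - (?q 0)\<^sup>2)) * (dA / sqrt (b * c))) (at 0)"
    using DERIV_chain2[OF DERIV_arccos[OF q1] dq] .
  moreover have "inverse (- sqrt (1 - (?q 0)\<^sup>2)) * (dA / sqrt (b * c)) = - dA / \<bar>triple (X 0) (Y 0) (Z 0)\<bar>"
    unfolding sq using bc by (simp add: real_sqrt_divide field_simps)
  ultimately show ?thesis
    unfolding angle_between_def cos_angle_between[OF unit] by simp
qed

text \<open>Composing with cos, which is differentiable everywhere, recovers the inner product from
  the edge length.\<close>

lemma inner_derivative_of_arccos_const: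
  fixes X Y :: "real \<Rightarrow> real^3"
  assumes unit: "\<And>t. norm (X t) = 1" "\<And>t. norm (Y t) = 1"
    and "((\<lambda>t. arccos (X t \<bullet> Y t)) has_real_derivative 0) (at 0)"
  shows "((\<lambda>t. X t \<bullet> Y t) has_real_derivative 0) (at 0)"
proof -
  have "((\<lambda>t. cos (arccos (X t \<bullet> Y t))) has_real_derivative 0) (at 0)"
    using DERIV_chain2[OF DERIV_cos assms(3)] by simp
  moreover have "\<bar>X t \<bullet> Y t\<bar> \<le> 1" for t
    using Cauchy_Schwarz_ineq2[of "X t" "Y t"] unit by simp
  ultimately show ?thesis by (simp add: cos_arccos_abs)
qed

section \<open>Supporting planes of a convex polygon\<close>

lemma span_of_triple_eq_0:
  assumes nz: "x \<times> y \<noteq> 0" and "triple x y z = 0"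
  shows "\<exists>a b. z = a *\<^sub>R x + b *\<^sub>R y"
proof -
  define N where "N = x \<times> y"
  have NN: "N \<bullet> N \<noteq> 0" using nz by (simp add: N_def)
  \<comment> \<open>Since \<open>z\<close> is orthogonal to \<open>N\<close>, the double cross
    product returns \<open>z\<close> scaled; expanding the inner product first gives the
    coefficients explicitly.\<close>
  have "(N \<bullet> N) *\<^sub>R z = N \<times> (z \<times> N)"
    unfolding Lagrange using assms(2) by (simp add: N_def)
  also have "z \<times> N = (z \<bullet> y) *\<^sub>R x - (z \<bullet> x) *\<^sub>R y" by (simp add: N_def Lagrange)
  also have "N \<times> \<dots> = - ((z \<bullet> y) *\<^sub>R (x \<times> N) - (z \<bullet> x) *\<^sub>R (y \<times> N))"
    by (subst cross_skew) (simp add: Cross3.left_diff_distrib cross_mult_left)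
  also have "\<dots> = ((z \<bullet> y) * (x \<bullet> x) - (z \<bullet> x) * (x \<bullet> y)) *\<^sub>R y +
       ((z \<bullet> x) * (y \<bullet> y) - (z \<bullet> y) * (x \<bullet> y)) *\<^sub>R x"
    unfolding N_def Lagrange by (simp add: algebra_simps inner_commute)
  finally have "(N \<bullet> N) *\<^sub>R z = \<dots>" .
  then have "inverse (N \<bullet> N) *\<^sub>R ((N \<bullet> N) *\<^sub>R z) = inverse (N \<bullet> N) *\<^sub>R (((z \<bullet> y) * (x \<bullet> x) - (z \<bullet> x) * (x \<bullet> y)) *\<^sub>R y +
       ((z \<bullet> x) * (y \<bullet> y) - (z \<bullet> y) * (x \<bullet> y)) *\<^sub>R x)" by (rule arg_cong)
  then have "z = inverse (N \<bullet> N) *\<^sub>R (((z \<bullet> y) * (x \<bullet> x) - (z \<bullet> x) * (x \<bullet> y)) *\<^sub>R y +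
       ((z \<bullet> x) * (y \<bullet> y) - (z \<bullet> y) * (x \<bullet> y)) *\<^sub>R x)" using NN by simp
  then show ?thesis unfolding scaleR_add_right scaleR_scaleR by (metis add.commute)
qed

lemma cross_nonzero_of_distinct:
  assumes "norm x = 1" "norm y = 1" "y \<noteq> x" "y \<noteq> - x"
  shows "x \<times> y \<noteq> 0"
proof
  assume "x \<times> y = 0"
  then have "x \<times> (x \<times> y) = 0" by simp
  then have eq: "y = (x \<bullet> y) *\<^sub>R x" unfolding Lagrange using assms by (simp add: norm_eq_1)
  then have "norm y = \<bar>x \<bullet> y\<bar> * norm x" by (metis norm_scaleR)
  then have "x \<bullet> y = 1 \<or> x \<bullet> y = -1" using assms by auto
  then show False using eq assms by auto
qed

lemma sgn_combination_in_segment: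
  assumes "0 \<le> a" "0 \<le> b" "a *\<^sub>R x + b *\<^sub>R y \<noteq> 0"
  shows "sgn (a *\<^sub>R x + b *\<^sub>R y) \<in> geodesic_segment x y"
proof -
  let ?w = "a *\<^sub>R x + b *\<^sub>R y"
  have "sgn ?w = (a / norm ?w) *\<^sub>R x + (b / norm ?w) *\<^sub>R y"
    by (simp add: sgn_div_norm scaleR_add_right divide_inverse mult.commute)
  moreover have "a / norm ?w \<ge> 0" "b / norm ?w \<ge> 0" using assms by auto
  moreover have "sgn ?w \<in> S2" using assms by (simp add: norm_sgn)
  ultimately show ?thesis unfolding geodesic_segment_def by blast
qed

text \<open>If \<open>x\<close> and \<open>- x\<close> both lie in \<open>D\<close>, openness allows
  a small move from \<open>- x\<close> towards any \<open>z\<close>. The arc from \<open>x\<close>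
  to the moved point is nearly half a great circle and runs through \<open>z\<close>, so
  \<open>D\<close> would be the whole sphere.\<close>

lemma convex_domain_no_antipodes:
  assumes D: "convex_domain D" and ne: "D \<noteq> S2" and "x \<in> D"
  shows "- x \<notin> D"
proof
  assume mx: "- x \<in> D"
  have sub: "D \<subseteq> S2" and seg: "\<And>x y. x \<in> D \<Longrightarrow> y \<in> D \<Longrightarrow> x \<noteq> - y \<Longrightarrow> geodesic_segment x y \<subseteq> D"
    using D by (auto simp: convex_domain_def spherically_convex_def)
  obtain W where W: "open W" "D = S2 \<inter> W"
    using D by (auto simp: convex_domain_def openin_open)
  have nx: "norm x = 1" using sub \<open>x \<in> D\<close> by auto
  have "z \<in> D" if z: "z \<in> S2" for z
  proof (cases "z = x \<or> z = - x")
    case True then show ?thesis using mx \<open>x \<in> D\<close> by auto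
  next
    case False
    have nz: "norm z = 1" using z by simp
    have ind: "x \<times> z \<noteq> 0" using cross_nonzero_of_distinct nx nz False by auto
    let ?g = "\<lambda>d. sgn (- x + d *\<^sub>R z)"
    have "?g \<midarrow>0\<rightarrow> sgn (- x + 0 *\<^sub>R z)"
      using nx by (intro tendsto_intros) auto
    then have "?g \<midarrow>0\<rightarrow> - x" using nx by (simp add: sgn_div_norm)
    then have "eventually (\<lambda>d. ?g d \<in> W) (at 0)"
      using W mx topological_tendstoD by blast
    then have "eventually (\<lambda>d. ?g d \<in> W) (at_right 0)" by (simp add: eventually_at_split)
    moreover have "eventually (\<lambda>d. d > (0::real)) (at_right 0)" by (rule eventually_at_right_less)
    ultimately have "eventually (\<lambda>d. ?g d \<in> W \<and> d > 0) (at_right 0)"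
      by (rule eventually_conj)
    then obtain d where d: "?g d \<in> W" "d > 0"
      using eventually_happens'[of "at_right (0::real)"] by auto
    let ?w = "- x + d *\<^sub>R z"
    have xw: "x \<times> ?w \<noteq> 0" using ind d(2) by (simp add: Cross3.right_diff_distrib cross_mult_right)
    then have w0: "?w \<noteq> 0" by (metis cross_zero_right)
    have "?g d \<in> D" using W d w0 by (simp add: norm_sgn)
    moreover have "x \<noteq> - ?g d"
    proof
      assume a: "x = - ?g d"
      have "norm ?w *\<^sub>R ?g d = ?w" using w0 by (simp add: sgn_div_norm)
      then have "?w = - (norm ?w *\<^sub>R x)" by (subst a) simp
      then have "x \<times> ?w = - (norm ?w *\<^sub>R (x \<times> x))" by (metis cross_minus_right cross_mult_right)
      then show False using xw by simp
    qed
    ultimately have "geodesic_segment x (?g d) \<subseteq> D" using seg \<open>x \<in> D\<close> by blast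
    moreover have "z \<in> geodesic_segment x (?g d)"
    proof -
      have "z = (1 / d) *\<^sub>R x + (norm ?w / d) *\<^sub>R ?g d"
      proof -
        have "(norm ?w / d) *\<^sub>R ?g d = (1 / d) *\<^sub>R (norm ?w *\<^sub>R ?g d)" by simp
        also have "norm ?w *\<^sub>R ?g d = ?w" using w0 by (simp add: sgn_div_norm)
        finally show ?thesis using d(2) by (simp add: scaleR_diff_right)
      qed
      moreover have "1 / d \<ge> 0" "norm ?w / d \<ge> 0" using d by auto
      ultimately show ?thesis unfolding geodesic_segment_def using z by blast
    qed
    ultimately show ?thesis by blast
  qed
  then show False using ne sub by blast
qed

text \<open>The cone \<open>K\<close> over \<open>D\<close> is convex in the ordinary sense: without
  antipodes in \<open>D\<close>, positive combinations do not vanish and project to points of arcs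
  in \<open>D\<close>. A plane separating \<open>m\<close> from \<open>K\<close> can be moved to the
  origin, and it contains \<open>m\<close> because \<open>m\<close> is in the closure of
  \<open>D\<close>.\<close>

lemma convex_domain_support:
  assumes D: "convex_domain D" and m: "m \<in> closure D" "m \<in> S2" "m \<notin> D"
  shows "\<exists>w. w \<noteq> 0 \<and> w \<bullet> m = 0 \<and> (\<forall>x\<in>closure D. 0 \<le> w \<bullet> x)"
proof -
  have sub: "D \<subseteq> S2" and seg: "\<And>x y. x \<in> D \<Longrightarrow> y \<in> D \<Longrightarrow> x \<noteq> - y \<Longrightarrow> geodesic_segment x y \<subseteq> D"
    and ne: "D \<noteq> {}"
    using D by (auto simp: convex_domain_def spherically_convex_def)
  have anti: "x \<noteq> - y" if "x \<in> D" "y \<in> D" for x y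
    using convex_domain_no_antipodes[OF D] m that by (metis minus_minus)
  define K where "K = {k *\<^sub>R d | k d. 0 < k \<and> d \<in> D}"
  have comb: "a *\<^sub>R x + b *\<^sub>R y \<in> K" if "a > 0" "b > 0" "x \<in> D" "y \<in> D" for a b x y
  proof -
    let ?w = "a *\<^sub>R x + b *\<^sub>R y"
    have "?w \<noteq> 0"
    proof
      assume "?w = 0"
      then have ab: "a *\<^sub>R x = b *\<^sub>R (- y)" by (simp add: add_eq_0_iff)
      then have "norm (a *\<^sub>R x) = norm (b *\<^sub>R (- y))" by simp
      then have "a = b" using that sub by (auto simp: subset_iff)
      then show False using ab anti that by (metis less_irrefl scaleR_cancel_left)
    qed
    then have "sgn ?w \<in> D" "?w = norm ?w *\<^sub>R sgn ?w" "norm ?w > 0"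
      using seg[OF that(3,4) anti[OF that(3,4)]] sgn_combination_in_segment[of a b x y] that
      by (auto simp: sgn_div_norm)
    then show ?thesis unfolding K_def by blast
  qed
  have "convex K"
  proof (rule convexI)
    fix x y and u v :: real
    assume "x \<in> K" "y \<in> K" and uv: "0 \<le> u" "0 \<le> v" "u + v = 1"
    then obtain k d k' d' where e: "x = k *\<^sub>R d" "y = k' *\<^sub>R d'" "k > 0" "k' > 0" "d \<in> D" "d' \<in> D"
      unfolding K_def by blast
    show "u *\<^sub>R x + v *\<^sub>R y \<in> K"
    proof (cases "u = 0 \<or> v = 0")
      case True then show ?thesis using uv \<open>x \<in> K\<close> \<open>y \<in> K\<close> by auto
    next
      case False
      then show ?thesis using comb[of "u * k" "v * k'" d d'] e uv by simp
    qed
  qed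
  moreover have "m \<notin> K"
  proof
    assume "m \<in> K"
    then obtain k d where kd: "m = k *\<^sub>R d" "k > 0" "d \<in> D" unfolding K_def by blast
    then have "k = 1" using m sub by (auto simp: subset_iff)
    then show False using kd m by simp
  qed
  moreover have "K \<noteq> {}" unfolding K_def using ne zero_less_one by blast
  ultimately obtain w b where w: "w \<noteq> 0" "w \<bullet> m \<le> b" "\<And>x. x \<in> K \<Longrightarrow> w \<bullet> x \<ge> b"
    using separating_hyperplane_sets[of "{m}" K] by auto
  \<comment> \<open>Scaling inside the cone: large factors exclude \<open>w \<bullet> d < 0\<close>,
    and small factors exclude \<open>b > 0\<close>.\<close>
  have bk: "b \<le> k * (w \<bullet> d)" if "d \<in> D" "k > 0" for k d
    using w(3)[of "k *\<^sub>R d"] that unfolding K_def by auto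
  have pos: "w \<bullet> d \<ge> 0" if "d \<in> D" for d
  proof (rule ccontr)
    assume n: "\<not> ?thesis"
    then have "b \<le> (\<bar>b\<bar> + 1) / (- (w \<bullet> d)) * (w \<bullet> d)" using that by (intro bk divide_pos_pos) auto
    also have "\<dots> = - (\<bar>b\<bar> + 1)" using n by simp
    finally show False by linarith
  qed
  have "b \<le> 0"
  proof (rule ccontr)
    assume b: "\<not> b \<le> 0"
    obtain d where d: "d \<in> D" using ne by blast
    have "w \<bullet> d > 0" using bk[OF d, of 1] b by simp
    then show False using bk[OF d, of "b / (2 * (w \<bullet> d))"] b by (simp add: field_simps)
  qed
  have "closure D \<subseteq> {x. 0 \<le> w \<bullet> x}"
    using pos by (intro closure_minimal) (auto simp: closed_halfspace_ge)
  then have cl: "\<forall>x\<in>closure D. 0 \<le> w \<bullet> x" by blast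
  then have "w \<bullet> m = 0" using w(2) \<open>b \<le> 0\<close> m(1) by fastforce
  with w(1) cl show ?thesis by blast
qed

text \<open>A supporting functional at the midpoint of the edge is nonnegative at both endpoints,
  and these two values sum to zero. It therefore vanishes on the edge and is a multiple of the
  normal; \<open>\<sigma>\<close> is the sign of the factor.\<close>

lemma convex_polygon_edge_halfspace:
  assumes "convex_polygon p" "i < length p"
  shows "\<exists>\<sigma>::real. \<sigma> * \<sigma> = 1 \<and> (\<forall>x\<in>set p. 0 \<le> \<sigma> * triple (p ! i) (next_vertex p i) x)"
proof -
  obtain D where D: "convex_domain D" and fr: "(top_of_set S2) frontier_of D = (\<Union>i<length p. edge p i)"
    and sp: "spherical_polygon p"
    using assms(1) unfolding convex_polygon_def by blast
  have "D \<subseteq> S2" using D by (auto simp: convex_domain_def spherically_convex_def)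
  \<comment> \<open>\<open>D\<close> is open in the sphere, so its frontier is its closure without
    \<open>D\<close>.\<close>
  then have fr': "S2 \<inter> closure D - D = (\<Union>i<length p. edge p i)"
    using D unfolding fr[symmetric] frontier_of_def closure_of_subtopology convex_domain_def
    by (simp add: interior_of_openin Int_absorb1)
  have sub: "set p \<subseteq> S2" using sp by (simp add: spherical_polygon_def)
  have nxt: "next_vertex p j \<in> set p" if "j < length p" for j
    unfolding next_vertex_def using that by (intro nth_mem mod_less_divisor) auto
  have vcl: "x \<in> closure D" if xp: "x \<in> set p" for x
  proof -
    obtain j where j: "j < length p" "x = p ! j" using xp by (auto simp: in_set_conv_nth)
    have "\<exists>a b. 0 \<le> a \<and> 0 \<le> b \<and> x = a *\<^sub>R (p ! j) + b *\<^sub>R next_vertex p j"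
      by (rule exI[of _ 1], rule exI[of _ 0]) (simp add: j)
    then have "x \<in> edge p j" unfolding edge_def geodesic_segment_def
      using sub that by blast
    then show ?thesis using fr' j by blast
  qed
  let ?x = "p ! i" and ?y = "next_vertex p i"
  have xy: "?x \<in> set p" "?y \<in> set p" using nxt assms(2) by auto
  have unit: "norm ?x = 1" "norm ?y = 1" using sub xy by auto
  have dist: "?y \<noteq> ?x" "?y \<noteq> - ?x" using sp assms(2) by (auto simp: spherical_polygon_def)
  have nz: "?x \<times> ?y \<noteq> 0" using cross_nonzero_of_distinct unit dist by blast
  let ?m = "sgn (?x + ?y)"
  have s0: "?x + ?y \<noteq> 0" using dist(2) by (simp add: add_eq_0_iff)
  then have "?m \<in> edge p i"
    unfolding edge_def using sgn_combination_in_segment[of 1 1 ?x ?y] by simp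
  then have "?m \<in> S2 \<inter> closure D - D" using fr' assms(2) by blast
  then obtain w where w: "w \<noteq> 0" "w \<bullet> ?m = 0" "\<And>x. x \<in> closure D \<Longrightarrow> 0 \<le> w \<bullet> x"
    using convex_domain_support[OF D] by blast
  have "w \<bullet> ?x + w \<bullet> ?y = 0" using w(2) s0 by (simp add: sgn_div_norm inner_add_right)
  then have w0: "w \<bullet> ?x = 0" "w \<bullet> ?y = 0" using w(3)[OF vcl[OF xy(1)]] w(3)[OF vcl[OF xy(2)]] by linarith+
  let ?N = "?x \<times> ?y"
  define c where "c = w \<bullet> ?N / (?N \<bullet> ?N)"
  have wc: "w = c *\<^sub>R ?N"
    using nz by (intro eq_of_inner_basis_eq[OF nz]) (auto simp: w0 dot_cross_self c_def)
  have "0 \<le> sgn c * triple ?x ?y x" if "x \<in> set p" for x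
  proof -
    have "0 \<le> c * triple ?x ?y x" using w(3)[OF vcl[OF that]] unfolding wc by simp
    then show ?thesis by (auto simp: sgn_if zero_le_mult_iff)
  qed
  moreover have "sgn c * sgn c = 1" using w(1) wc by (auto simp: sgn_if)
  ultimately show ?thesis by blast
qed

text \<open>Three consecutive vertices are treated first. Their strict determinants force
  neighbouring edges to have the same sign \<open>\<sigma>\<close>, and the common sign then
  excludes any further vertex on the great circle of an edge.\<close>

lemma strictly_convex_of_simple:
  fixes v :: "nat \<Rightarrow> real^3"
  assumes n0: "n > 0" and vper: "\<And>i. v (i + n) = v i" and unit: "\<And>i. norm (v i) = 1"
    and nz: "\<And>i. v i \<times> v (i + 1) \<noteq> 0"
    and half: "\<And>i. \<exists>\<sigma>::real. \<sigma> * \<sigma> = 1 \<and> (\<forall>j. 0 \<le> \<sigma> * triple (v i) (v (i + 1)) (v j))"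
    and simple: "\<And>i j. i mod n \<noteq> j mod n \<Longrightarrow>
      (geodesic_segment (v i) (v (i + 1)) - {v (i + 1)}) \<inter>
      (geodesic_segment (v j) (v (j + 1)) - {v (j + 1)}) = {}"
    and angle: "\<And>i. angle_between (v i) (v (i + 1)) (v (i + 2)) < pi"
  shows "n \<ge> 3 \<and> (\<exists>\<epsilon>::real. \<epsilon> * \<epsilon> = 1 \<and>
    (\<forall>i j. 2 \<le> j \<longrightarrow> j < n \<longrightarrow> \<epsilon> * triple (v i) (v (i + 1)) (v (i + j)) > 0))"
proof -
  have modne: "(i + j) mod n \<noteq> (i + k) mod n" if "k < j" "j < k + n" for i j k
  proof -
    have "\<not> n dvd (j - k)" using that by (auto dest: dvd_imp_le)
    then show ?thesis using that mod_eq_dvd_iff_nat[of "i + k" "i + j" n] by simp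
  qed
  have n2: "n \<ge> 2"
  proof (rule ccontr)
    assume "\<not> ?thesis"
    then have "n = 1" using n0 by simp
    then show False using nz[of 0] vper[of 0] by simp
  qed
  have on_edge: "v i \<in> geodesic_segment (v i) (v (i + 1)) - {v (i + 1)}" for i
  proof -
    have "v i \<noteq> v (i + 1)" using nz[of i] by force
    moreover have "\<exists>a b. 0 \<le> a \<and> 0 \<le> b \<and> v i = a *\<^sub>R v i + b *\<^sub>R v (i + 1)"
      by (rule exI[of _ 1], rule exI[of _ 0]) simp
    ultimately show ?thesis unfolding geodesic_segment_def using unit by auto
  qed
  have consec: "triple (v i) (v (i + 1)) (v (i + 2)) \<noteq> 0" for i
  proof
    let ?x = "v i" and ?y = "v (i + 1)" and ?z = "v (i + 2)"
    have yz: "?y \<times> ?z \<noteq> 0" using nz[of "i + 1"] by simp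
    then have zy: "?z \<times> ?y \<noteq> 0" by (subst cross_skew) simp
    assume "triple ?x ?y ?z = 0"
    then obtain a b where ab: "?z = a *\<^sub>R ?x + b *\<^sub>R ?y" using span_of_triple_eq_0 nz by blast
    have a0: "a \<noteq> 0" using yz ab by (auto simp: cross_mult_right)
    show False
    \<comment> \<open>The sign of \<open>a\<close> tells whether the path goes straight on at
      \<open>v (i + 1)\<close>, giving angle \<open>pi\<close>, or turns back along the edge just
      traversed.\<close>
    proof (cases "a < 0")
      case True
      have "tangent_towards ?y ?z = a *\<^sub>R tangent_towards ?y ?x"
        unfolding ab tangent_towards_def
        using unit[of "i+1"] by (simp add: inner_add_left norm_eq_1 algebra_simps)
      then have "sgn (tangent_towards ?y ?z) = - sgn (tangent_towards ?y ?x)"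
        using True by (simp add: sgn_scaleR)
      moreover have "tangent_towards ?y ?x \<noteq> 0"
      proof
        assume "tangent_towards ?y ?x = 0"
        then have "?x = (?x \<bullet> ?y) *\<^sub>R ?y" by (simp add: tangent_towards_def)
        then have "?x \<times> ?y = 0" by (metis cross_mult_left cross_refl scale_zero_right)
        then show False using nz by blast
      qed
      ultimately have "angle_between ?x ?y ?z = pi"
        unfolding angle_between_def by (simp add: dot_square_norm norm_sgn)
      then show False using angle[of i] by simp
    next
      case False
      \<comment> \<open>The edges leave \<open>v (i + 1)\<close> in the same direction, so they overlap near it.\<close>
      define k where "k = \<bar>b\<bar> + 1"
      let ?w = "1 *\<^sub>R ?z + k *\<^sub>R ?y"
      have "k > 0" by (simp add: k_def)
      have yw: "?y \<times> ?w \<noteq> 0" using yz by (simp add: cross_add_right cross_mult_right)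
      have zw: "?z \<times> ?w \<noteq> 0" using zy \<open>k > 0\<close> by (simp add: cross_add_right cross_mult_right)
      have w0: "?w \<noteq> 0" using yw by (metis cross_zero_right)
      \<comment> \<open>The choice \<open>k = \<bar>b\<bar> + 1\<close> makes \<open>b + k\<close>
        positive, so the point has nonnegative coefficients with respect to both edges.\<close>
      have w1: "?w = a *\<^sub>R ?x + (b + k) *\<^sub>R ?y" unfolding ab by (simp add: algebra_simps)
      have in1: "sgn ?w \<in> geodesic_segment ?x ?y"
        using w0 False unfolding w1 by (intro sgn_combination_in_segment) (auto simp: k_def)
      have in2: "sgn ?w \<in> geodesic_segment ?y ?z"
        using sgn_combination_in_segment[of k 1 ?y ?z] w0 \<open>k > 0\<close>
        by (simp add: add.commute)
      have par: "q \<times> ?w = 0" if "sgn ?w = q" for q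
        unfolding that[symmetric] by (simp add: sgn_div_norm cross_mult_left)
      have ne: "sgn ?w \<noteq> ?y" "sgn ?w \<noteq> ?z" using par yw zw by blast+
      have m1: "i mod n \<noteq> (i + 1) mod n" using modne[of 0 1 i] n2 by simp
      have "i + 1 + 1 = i + 2" by simp
      with simple[OF m1] in1 in2 ne show False by (metis DiffI IntI empty_iff singletonD)
    qed
  qed
  have "n \<noteq> 2" using consec[of 0] vper[of 0] by (auto simp: cross3_simps numeral_2_eq_2)
  then have n3: "n \<ge> 3" using n2 by simp
  obtain \<sigma> :: "nat \<Rightarrow> real" where s1: "\<And>i. \<sigma> i * \<sigma> i = 1"
    and sh: "\<And>i j. 0 \<le> \<sigma> i * triple (v i) (v (i + 1)) (v j)"
    using choice[of "\<lambda>i \<sigma>. \<sigma> * \<sigma> = 1 \<and> (\<forall>j. 0 \<le> \<sigma> * triple (v i) (v (i + 1)) (v j))"] half by blast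
  have spos: "\<sigma> i * triple (v i) (v (i + 1)) (v (i + 2)) > 0" for i
    using sh[of i "i + 2"] consec[of i] s1[of i] by (auto simp: le_less)
  have "\<sigma> (Suc i) = \<sigma> i" for i
  proof -
    \<comment> \<open>By cyclic permutation one determinant tests \<open>v (i + 2)\<close> against
      edge \<open>i\<close> and \<open>v i\<close> against edge \<open>i + 1\<close>; being nonzero,
      it fixes both signs.\<close>
    have "0 \<le> \<sigma> (Suc i) * triple (v i) (v (i + 1)) (v (i + 2))"
      using sh[of "Suc i" i] cross_triple[of "v i" "v (i + 1)" "v (i + 2)"] by simp
    moreover have "\<sigma> (Suc i) = 1 \<or> \<sigma> (Suc i) = -1" "\<sigma> i = 1 \<or> \<sigma> i = -1"
      using s1 by (simp_all add: square_eq_1_iff)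
    ultimately show ?thesis using spos[of i] by auto
  qed
  then have const: "\<sigma> i = \<sigma> 0" for i by (induction i) auto
  have "\<sigma> 0 * triple (v i) (v (i + 1)) (v (i + j)) > 0" if j: "2 \<le> j" "j < n" for i j
  proof -
    have "triple (v i) (v (i + 1)) (v (i + j)) \<noteq> 0"
    proof
      assume "triple (v i) (v (i + 1)) (v (i + j)) = 0"
      then obtain a b where ab: "v (i + j) = a *\<^sub>R v i + b *\<^sub>R v (i + 1)"
        using span_of_triple_eq_0 nz by blast
      \<comment> \<open>The half-space of the next edge gives \<open>a \<ge> 0\<close>, that of the
        previous edge gives \<open>b \<ge> 0\<close>, so \<open>v (i + j)\<close> would lie on edge
        \<open>i\<close>, against simplicity.\<close>
      have "triple (v (i + 1)) (v (i + 2)) (v (i + j)) = a * triple (v i) (v (i + 1)) (v (i + 2))"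
        unfolding ab cross_triple[of "v i" "v (i + 1)" "v (i + 2)"]
        by (simp add: inner_add_right dot_cross_self inner_commute)
      then have "0 \<le> a * (\<sigma> 0 * triple (v i) (v (i + 1)) (v (i + 2)))"
        using sh[of "i + 1" "i + j"] const[of "i + 1"] by (simp add: mult.left_commute)
      then have a: "a \<ge> 0" using spos[of i] const[of i] by (simp add: zero_le_mult_iff)
      \<comment> \<open>The previous index, raised by a period so that natural subtraction does not
        truncate at \<open>i = 0\<close>.\<close>
      define l where "l = i + n - 1"
      have l: "v (l + 1) = v i" "v (l + 2) = v (i + 1)"
        using vper[of i] vper[of "i + 1"] n2 by (simp_all add: l_def)
      have "triple (v l) (v i) (v (i + j)) = b * triple (v l) (v i) (v (i + 1))"
        unfolding ab by (simp add: inner_add_right dot_cross_self)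
      then have "0 \<le> b * (\<sigma> 0 * triple (v l) (v i) (v (i + 1)))"
        using sh[of l "i + j"] const[of l] l by (simp add: mult.left_commute)
      then have b: "b \<ge> 0" using spos[of l] const[of l] l by (simp add: zero_le_mult_iff)
      have seg: "v (i + j) \<in> geodesic_segment (v i) (v (i + 1))"
      proof -
        have "v (i + j) \<in> S2" using unit by simp
        then show ?thesis unfolding geodesic_segment_def using a b ab by blast
      qed
      have m0: "(i + j) mod n \<noteq> i mod n" and m1: "(i + j) mod n \<noteq> (i + 1) mod n"
        using modne[of 0 j i] modne[of 1 j i] j by simp_all
      have "v (i + j) \<noteq> v (i + 1)"
        using on_edge[of "i + j"] on_edge[of "i + 1"] simple[OF m1] by (metis IntI empty_iff)
      then show False
        using on_edge[of "i + j"] seg simple[OF m0] by blast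
    qed
    then show ?thesis using sh[of i "i + j"] const[of i] s1[of 0] by (auto simp: le_less)
  qed
  then show ?thesis using n3 s1[of 0] by blast
qed

section \<open>From list polygons to periodic sequences, rotation vectors and the sign of the
  invariant\<close>

theorem mainTheorem4:
  fixes p U :: "(real ^ 3) list"
  assumes "convex_polygon p"
    and "isometric_deformation p U"
    and "\<not> trivial_deformation p U"
  shows "quadratic_invariant p U \<in> {c *\<^sub>R x | c x. 0 < c \<and> x \<in> dual_interior p}"
proof -
  define n where "n = length p"
  define v u where "v i = p ! (i mod n)" and "u i = U ! (i mod n)" for i
  have sp: "spherical_polygon p" and simple: "simple_polygon p"
    and ang: "\<And>i. i < n \<Longrightarrow> vertex_angle p i < pi"
    using assms(1) by (auto simp: convex_polygon_def n_def)
  have n0: "n > 0" using sp by (simp add: n_def spherical_polygon_def)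
  have lenU: "length U = n" and orth: "\<And>i. u i \<bullet> v i = 0"
    using assms(2) n0 by (auto simp: isometric_deformation_def first_order_deformation_def n_def v_def u_def)
  have vper: "v (i + n) = v i" and uper: "u (i + n) = u i" for i by (simp_all add: v_def u_def)
  have vmod: "v (i mod n) = v i" "v (i mod n + 1) = v (i + 1)" "v (i mod n + 2) = v (i + 2)"
    and umod: "u (i mod n) = u i" "u (i mod n + 1) = u (i + 1)" "u (i mod n + 2) = u (i + 2)" for i
    by (simp_all add: v_def u_def mod_simps)
  have vin: "v i \<in> set p" for i using n0 by (simp add: v_def n_def)
  have unit: "norm (v i) = 1" for i using vin sp by (force simp: spherical_polygon_def)
  have nxt: "next_vertex p (i mod n) = v (i + 1)" for i
    by (simp add: next_vertex_def v_def n_def mod_simps)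
  have pv: "p ! (i mod n) = v i" for i by (simp add: v_def)
  have dist: "v (i + 1) \<noteq> v i" "v (i + 1) \<noteq> - v i" for i
    using sp n0 nxt[of i] pv[of i] unfolding spherical_polygon_def n_def
    by (metis mod_less_divisor)+
  have nz: "v i \<times> v (i + 1) \<noteq> 0" for i using cross_nonzero_of_distinct unit dist by blast
  have prv: "prev_vertex q ((i + 1) mod n) = q ! (i mod n)" if "length q = n" for q i
  proof -
    have "((i + 1) mod n + n - 1) mod n = ((i + 1) mod n + (n - 1)) mod n" using n0 by simp
    also have "\<dots> = (i + 1 + (n - 1)) mod n" by (rule mod_add_left_eq)
    also have "\<dots> = i mod n" using n0 by simp
    finally show ?thesis by (simp add: prev_vertex_def that)
  qed
  have nxt': "next_vertex q ((i + 1) mod n) = q ! ((i + 2) mod n)" if "length q = n" for q i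
    by (simp add: next_vertex_def that mod_simps)

  define X where "X i t = sgn (v i + t *\<^sub>R u i)" for i t
  have X0: "X i 0 = v i" for i using unit by (simp add: X_def sgn_div_norm)
  have Xunit: "norm (X i t) = 1" for i t
  proof -
    have "v i \<bullet> (v i + t *\<^sub>R u i) = 1"
      using unit orth[of i] by (simp add: inner_add_right norm_eq_1 inner_commute)
    then have "v i + t *\<^sub>R u i \<noteq> 0" by force
    then show ?thesis by (simp add: X_def norm_sgn)
  qed
  have deflen: "length (deform p U t) = n" for t by (simp add: deform_def lenU n_def)
  have defX: "deform p U t ! (i mod n) = X i t" for i t
    using n0 lenU by (simp add: deform_def X_def v_def u_def n_def)
  have dinner: "((\<lambda>t. X i t \<bullet> X j t) has_real_derivative (u i \<bullet> v j + v i \<bullet> u j)) (at 0)" for i j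
    unfolding X_def by (intro sgn_curves_inner_derivative unit orth)

  have iso: "((\<lambda>t. X i t \<bullet> X (i + 1) t) has_real_derivative 0) (at 0)" for i
  proof -
    have "edge_length (deform p U t) (i mod n) = arccos (X i t \<bullet> X (i + 1) t)" for t
      using defX[of t "i + 1"] by (simp add: edge_length_def next_vertex_def deflen defX mod_simps)
    moreover have "((\<lambda>t. edge_length (deform p U t) (i mod n)) has_real_derivative 0) (at 0)"
      using assms(2) n0 by (simp add: isometric_deformation_def n_def)
    ultimately show ?thesis using Xunit by (intro inner_derivative_of_arccos_const) simp_all
  qed
  have iso0: "u i \<bullet> v (i + 1) + v i \<bullet> u (i + 1) = 0" for i
    using DERIV_unique[OF dinner iso] .
  have "\<exists>Y. u i = Y \<times> v i \<and> u (i + 1) = Y \<times> v (i + 1)" for i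
    using exists_rotation_field[OF nz orth orth iso0] .
  then obtain Y' where Y': "\<And>i. u i = Y' i \<times> v i \<and> u (i + 1) = Y' i \<times> v (i + 1)"
    using choice[of "\<lambda>i Y. u i = Y \<times> v i \<and> u (i + 1) = Y \<times> v (i + 1)"] by blast
  \<comment> \<open>The vectors \<open>Y'\<close> were chosen separately for each index; reducing
    the index makes the choice periodic.\<close>
  define Y where "Y i = Y' (i mod n)" for i
  have Y: "u i = Y i \<times> v i" "u (i + 1) = Y i \<times> v (i + 1)" for i
    using Y'[of "i mod n"] unfolding Y_def vmod umod by auto
  have Yper: "Y (i + n) = Y i" for i by (simp add: Y_def)

  have "n \<ge> 3 \<and> (\<exists>\<epsilon>::real. \<epsilon> * \<epsilon> = 1 \<and>
    (\<forall>i j. 2 \<le> j \<longrightarrow> j < n \<longrightarrow> \<epsilon> * triple (v i) (v (i + 1)) (v (i + j)) > 0))"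
  proof (rule strictly_convex_of_simple[OF n0 vper unit nz])
    fix i
    show "\<exists>\<sigma>::real. \<sigma> * \<sigma> = 1 \<and> (\<forall>j. 0 \<le> \<sigma> * triple (v i) (v (i + 1)) (v j))"
      using convex_polygon_edge_halfspace[OF assms(1), of "i mod n"] n0 vin
      unfolding nxt pv n_def[symmetric] by (meson mod_less_divisor)
  next
    fix i j assume "i mod n \<noteq> j mod n"
    moreover have "edge p (k mod n) = geodesic_segment (v k) (v (k + 1))" for k
      unfolding edge_def nxt pv ..
    moreover have "i mod n < n" "j mod n < n" using n0 by simp_all
    ultimately show "(geodesic_segment (v i) (v (i + 1)) - {v (i + 1)}) \<inter>
      (geodesic_segment (v j) (v (j + 1)) - {v (j + 1)}) = {}"
      using simple unfolding simple_polygon_def n_def[symmetric] by (metis nxt)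
  next
    fix i
    have "vertex_angle p ((i + 1) mod n) = angle_between (v i) (v (i + 1)) (v (i + 2))"
      unfolding vertex_angle_def angle_between_def
      by (simp only: prv[OF n_def[symmetric]] nxt'[OF n_def[symmetric]] pv)
    then show "angle_between (v i) (v (i + 1)) (v (i + 2)) < pi"
      using ang[of "(i + 1) mod n"] n0 by simp
  qed
  then obtain \<epsilon> :: real where n3: "n \<ge> 3" and eps: "\<epsilon> * \<epsilon> = 1"
    and edge: "\<And>i j. 2 \<le> j \<Longrightarrow> j < n \<Longrightarrow> \<epsilon> * triple (v i) (v (i + 1)) (v (i + j)) > 0"
    by blast

  define a where "a i = angle_variation p U (i mod n)" for i
  have aper: "a (i + n) = a i" for i by (simp add: a_def)
  \<comment> \<open>Both \<open>Y i\<close> and \<open>Y (Suc i)\<close> give the velocity of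
    \<open>v (Suc i)\<close>, so they differ by \<open>l\<close> times that vertex. Then
    \<open>v i \<bullet> v (i + 2)\<close> varies at rate \<open>l * ?T\<close>, and the angle
    formula with \<open>\<bar>?T\<bar> = \<epsilon> * ?T\<close> yields
    \<open>\<epsilon> * a (Suc i) = - l\<close>.\<close>
  have step: "Y (Suc i) = Y i - (\<epsilon> * a (Suc i)) *\<^sub>R v (Suc i)" for i
  proof -
    define l where "l = (Y (Suc i) - Y i) \<bullet> v (Suc i)"
    let ?T = "triple (v i) (v (i + 1)) (v (i + 2))"
    have "Y (Suc i) \<times> v (Suc i) = Y i \<times> v (Suc i)" using Y(1)[of "Suc i"] Y(2)[of i] by simp
    then have lY: "Y (Suc i) - Y i = l *\<^sub>R v (Suc i)"
      unfolding l_def by (intro parallel_of_cross_eq unit)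
    have "u i \<bullet> v (i + 2) + v i \<bullet> u (i + 2) = - ((Y (Suc i) - Y i) \<bullet> (v i \<times> v (i + 2)))"
    proof -
      have "u i = Y i \<times> v i" "u (i + 2) = Y (Suc i) \<times> v (i + 2)"
        using Y(1)[of i] Y(2)[of "Suc i"] by simp_all
      then show ?thesis by (simp add: cross3_simps)
    qed
    also have "\<dots> = l * ?T" unfolding lY by (simp add: cross3_simps)
    finally have dA: "u i \<bullet> v (i + 2) + v i \<bullet> u (i + 2) = l * ?T" .
    have eT: "\<epsilon> * ?T > 0" using edge[of 2 i] n3 by simp
    then have T0: "triple (X i 0) (X (i + 1) 0) (X (i + 2) 0) \<noteq> 0" unfolding X0 by auto
    have iso2: "((\<lambda>t. X (i + 2) t \<bullet> X (i + 1) t) has_real_derivative 0) (at 0)"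
      using iso[of "i + 1"] by (simp add: inner_commute)
    have va: "vertex_angle (deform p U t) ((i + 1) mod n) = angle_between (X i t) (X (i + 1) t) (X (i + 2) t)" for t
      unfolding vertex_angle_def angle_between_def by (simp only: prv[OF deflen] nxt'[OF deflen] defX)
    have "a (i + 1) = - (l * ?T) / \<bar>?T\<bar>"
      unfolding a_def angle_variation_def va
      using DERIV_imp_deriv[OF angle_between_has_derivative[OF Xunit Xunit Xunit dinner iso iso2 T0]]
      unfolding X0 dA .
    moreover have "\<bar>?T\<bar> = \<epsilon> * ?T"
      using eT eps by (auto simp: square_eq_1_iff)
    moreover have "?T \<noteq> 0" "\<epsilon> \<noteq> 0" using eT eps by auto
    ultimately have "\<epsilon> * a (Suc i) = - l" by (simp add: field_simps)
    then show ?thesis using lY by (simp add: algebra_simps)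
  qed

  obtain k0 where k0: "a k0 \<noteq> 0"
  proof (rule ccontr)
    assume "\<not> thesis"
    then have "a i = 0" for i using that by blast
    then have "Y (Suc i) = Y i" for i using step by simp
    then have Yc: "Y i = Y 0" for i by (induction i) auto
    have "U ! i = cross3 (Y 0) (p ! i)" if "i < n" for i
      using Y(1)[of i] that unfolding Yc[of i] by (simp add: u_def v_def)
    then have "trivial_deformation p U" using lenU unfolding trivial_deformation_def n_def by blast
    then show False using assms(3) by blast
  qed

  let ?b = "quadratic_invariant p U"
  have b: "?b = (\<Sum>i<n. a i *\<^sub>R u i)"
    by (simp add: quadratic_invariant_def a_def u_def n_def)
  have pos: "?b \<bullet> v k > 0" for k
  proof -
    have "(\<Sum>i<n. a (i + k) * triple (Y (i + k)) (v (i + k)) (v (0 + k))) > 0"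
    proof (rule polygon_form_pos[OF n3 eps])
      \<comment> \<open>The shifted sequence needs an index that \<open>k\<close> more steps carry
        to \<open>k0\<close> modulo \<open>n\<close>; going forward \<open>k * (n - 1)\<close> steps
        replaces going back \<open>k\<close>.\<close>
      show "a (k0 + k * (n - 1) + k) \<noteq> 0"
      proof -
        have "k0 + k * (n - 1) + k = k0 + k * n" using n0 by (cases n) simp_all
        then show ?thesis using k0 by (simp only: a_def mod_mult_self1 not_False_eq_True)
      qed
      show "v (i + n + k) = v (i + k)" "Y (i + n + k) = Y (i + k)" "a (i + n + k) = a (i + k)" for i
        using vper[of "i + k"] Yper[of "i + k"] aper[of "i + k"] by (simp_all add: ac_simps)
      show "\<epsilon> * triple (v (i + k)) (v (i + 1 + k)) (v (i + j + k)) > 0" if "2 \<le> j" "j < n" for i j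
        using edge[OF that, of "i + k"] by (simp add: ac_simps)
      show "Y (Suc i + k) = Y (i + k) - (\<epsilon> * a (Suc i + k)) *\<^sub>R v (Suc i + k)" for i
        using step[of "i + k"] by simp
    qed
    also have "(\<Sum>i<n. a (i + k) * triple (Y (i + k)) (v (i + k)) (v (0 + k))) =
        (\<Sum>i<n. a i * triple (Y i) (v i) (v k))"
      using sum_periodic_shift[of "\<lambda>i. a i * triple (Y i) (v i) (v k)" n k]
      by (simp add: vper Yper aper)
    also have "\<dots> = ?b \<bullet> v k"
      unfolding b inner_sum_left by (simp add: Y(1)[symmetric])
    finally show ?thesis .
  qed
  have "?b \<noteq> 0" using pos[of 0] by auto
  moreover have "sgn ?b \<bullet> x > 0" if "x \<in> set p" for x
  proof -
    obtain i where "i < n" "x = p ! i" using \<open>x \<in> set p\<close> unfolding n_def in_set_conv_nth by blast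
    then have "?b \<bullet> x > 0" using pos[of i] by (simp add: v_def)
    then show ?thesis using \<open>?b \<noteq> 0\<close> by (simp add: sgn_div_norm)
  qed
  ultimately have "sgn ?b \<in> dual_interior p" "norm ?b > 0" "?b = norm ?b *\<^sub>R sgn ?b"
    by (auto simp: dual_interior_def norm_sgn sgn_div_norm)
  then show ?thesis by blast
qed

end
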